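(* Let $\mu$ be a positive measure on $\mathbb{R}^d$, let $0<\eta<1$, and let $\mathcal{E}$ be a collection of measurable sets of finite $\mu$-measure. If $M_\eta=M_\eta(\mathcal{E})<\infty$ and $A$ is the output constant of the improved greedy algorithm described in the context, run on $\mathcal{E}$ with parameter $\eta$, then $$A\le\|\mathcal{E}\|_{\mathrm{Carleson}(\mu)}\le 2(1-\eta)^{-1}M_\eta\,A.$$
   Context: A collection is a finite unordered sequence of sets; repeated elements are allowed, and sums over a collection count multiplicity. The convention $\frac00=0$ is used. For a collection $\mathcal{F}$ put $\mathrm{sh}(\mathcal{F})=\bigcup_{R\in\mathcal{F}}R$ and $h_{\mathcal{F}}=\sum_{R\in\mathcal{F}}\mathbbm{1}_R$. The Carleson constant is $$\|\mathcal{E}\|_{\mathrm{Carleson}(\mu)}=\sup\Bigl\{\frac{1}{\mu(\mathrm{sh}(\mathcal{F}))}\sum_{R\in\mathcal{F}}\mu(R):\ \mathcal{F}\subseteq\mathcal{E}\Bigr\}.$$ The maximal operator of $\mathcal{E}$ is $\mathcal{M}_{\mathcal{E}}f(x)=\sup_{R\in\mathcal{E}}\frac{\mathbbm{1}_R(x)}{\mu(R)}\int_R|f|\,d\mu$, and $M_\eta(\mathcal{E})$ is the best constant $M$ in the inequality $$\mu\bigl(\{x:\ \mathcal{M}_{\mathcal{E}}(\mathbbm{1}_E)(x)>\eta\}\bigr)\le M\,\mu(E)\qquad\text{for all measurable sets }E.$$ $\Lambda^{1,\infty}_\mu(\mathcal{E})$ is the best constant $\Lambda$ in the inequality $$\sup_{\lambda>0}\lambda\,\mu(\{x:\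 h_{\mathcal{E}}(x)>\lambda\})\le\Lambda\,\mu(\mathrm{sh}(\mathcal{E})).$$ The improved greedy algorithm, with input a collection $\mathcal{E}$: set $A=1$. While the current collection (still denoted $\mathcal{E}$) is non-empty, do the following: (1) replace $A$ by $\max(A,\Lambda^{1,\infty}_\mu(\mathcal{E}))$, where $\mathcal{E}$ is the current collection; (2) for $R$ in the current collection let $F(R)=\{x\in R:\ h_{\mathcal{E}}(x)\le 2M_\eta(\mathcal{E})\Lambda^{1,\infty}_\mu(\mathcal{E})\}$; run through the elements of the current collection until finding an $R$ with $\mu(F(R))\ge(1-\eta)\mu(R)$; remove this one $R$ from $\mathcal{E}$, record $E(R):=F(R)$ and $\Lambda_R:=\Lambda^{1,\infty}_\mu(\mathcal{E})$ (computed before the removal), and return to step (1) with the reduced collection. (Such an $R$ always exists, so the algorithm terminates.) The output is the final constant $A$, together with the sequence $\{\Lambda_R\}$ and the sets $\{E(R)\}$.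
   Formalization: The collection is additionally assumed to contain a set of positive measure: if it is empty or all its sets are null, its Carleson constant is 0 while the algorithm outputs A = 1, so the left inequality fails. *)

theory Defs
  imports "HOL-Analysis.Analysis" "HOL-Library.Multiset"
begin

text \<open>
  Collections are finite multisets of sets. All constants take values in \<^typ>\<open>ennreal\<close>,
  where \<open>0 / 0 = 0\<close> and \<open>\<infinity> * 0 = 0\<close>, in accordance with the convention \<open>0 / 0 = 0\<close>.
\<close>

definition shadow :: "'a set multiset \<Rightarrow> 'a set" where
  "shadow \<F> = \<Union> (set_mset \<F>)"

definition overlap :: "'a set multiset \<Rightarrow> 'a \<Rightarrow> ennreal" where
  "overlap \<F> x = (\<Sum>R\<in>#\<F>. indicator R x)"

definition carleson_const :: "'a measure \<Rightarrow> 'a set multiset \<Rightarrow> ennreal" where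
  "carleson_const M \<E> =
     (SUP \<F>\<in>{\<F>. \<F> \<subseteq># \<E>}. (\<Sum>R\<in>#\<F>. emeasure M R) / emeasure M (shadow \<F>))"

definition maximal_op :: "'a measure \<Rightarrow> 'a set multiset \<Rightarrow> ('a \<Rightarrow> real) \<Rightarrow> 'a \<Rightarrow> ennreal" where
  "maximal_op M \<E> f x =
     (SUP R\<in>set_mset \<E>.
        indicator R x / emeasure M R * (\<integral>\<^sup>+y\<in>R. ennreal \<bar>f y\<bar> \<partial>M))"

text \<open>A best constant is the infimum of the set of all admissible constants in \<open>[0, \<infinity>]\<close>.\<close>

definition maximal_const :: "'a measure \<Rightarrow> real \<Rightarrow> 'a set multiset \<Rightarrow> ennreal" where
  "maximal_const M \<eta> \<E> =
     Inf {C. \<forall>E\<in>sets M.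
       emeasure M {x\<in>space M. maximal_op M \<E> (indicator E) x > ennreal \<eta>} \<le> C * emeasure M E}"

definition weak_const :: "'a measure \<Rightarrow> 'a set multiset \<Rightarrow> ennreal" where
  "weak_const M \<E> =
     Inf {C. (SUP l\<in>{0<..}. ennreal l * emeasure M {x\<in>space M. overlap \<E> x > ennreal l})
               \<le> C * emeasure M (shadow \<E>)}"

definition greedy_part :: "'a measure \<Rightarrow> real \<Rightarrow> 'a set multiset \<Rightarrow> 'a set \<Rightarrow> 'a set" where
  "greedy_part M \<eta> \<E> R =
     {x\<in>R. overlap \<E> x \<le> 2 * maximal_const M \<eta> \<E> * weak_const M \<E>}"

text \<open>
  \<open>greedy_loop M \<eta> \<E> A B out\<close>: the loop, entered with current collection \<open>\<E>\<close> and current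
  constant \<open>A\<close>, can terminate with final constant \<open>B\<close>, recording the list \<open>out\<close> of triples
  \<open>(R, \<Lambda>\<^sub>R, E(R))\<close> in order of removal. It is a relation because the order in which the
  elements of a collection are inspected is unspecified: any admissible \<open>R\<close> may be removed.
  Removal deletes a single occurrence of \<open>R\<close>.
\<close>

inductive greedy_loop ::
    "'a measure \<Rightarrow> real \<Rightarrow> 'a set multiset \<Rightarrow> ennreal \<Rightarrow> ennreal
       \<Rightarrow> ('a set \<times> ennreal \<times> 'a set) list \<Rightarrow> bool"
  for M :: "'a measure" and \<eta> :: real
where
  stop: "greedy_loop M \<eta> {#} A A []"
| step: "\<lbrakk>R \<in># \<E>;
          emeasure M (greedy_part M \<eta> \<E> R) \<ge> ennreal (1 - \<eta>) * emeasure M R;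
          greedy_loop M \<eta> (\<E> - {#R#}) (max A (weak_const M \<E>)) B out\<rbrakk>
         \<Longrightarrow> greedy_loop M \<eta> \<E> A B ((R, weak_const M \<E>, greedy_part M \<eta> \<E> R) # out)"

definition improved_greedy ::
    "'a measure \<Rightarrow> real \<Rightarrow> 'a set multiset \<Rightarrow> ennreal
       \<Rightarrow> ('a set \<times> ennreal \<times> 'a set) list \<Rightarrow> bool" where
  "improved_greedy M \<eta> \<E> A out \<longleftrightarrow> greedy_loop M \<eta> \<E> 1 A out"

end

theory Submission
  imports Defs
begin

text \<open>
  The lower bound is Chebyshev's inequality for the overlap function of each intermediate
  collection. For the upper bound fix a point \<open>x\<close> and look at the first removed \<open>R\<close> with
  \<open>x \<in> E(R)\<close>: all later sets \<open>E(R')\<close> containing \<open>x\<close> are counted by the overlap function of the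
  collection at that stage, which at \<open>x\<close> is at most \<open>2 M\<^sub>\<eta> \<Lambda>\<^sub>R \<le> 2 M\<^sub>\<eta> A\<close>. Hence the sets
  \<open>E(R)\<close> have overlap at most \<open>2 M\<^sub>\<eta> A\<close>, while carrying the fraction \<open>1 - \<eta>\<close> of the mass.
\<close>

lemma overlap_empty [simp]: "overlap {#} = (\<lambda>_. 0)"
  by (simp add: overlap_def fun_eq_iff)

lemma overlap_add_mset [simp]: "overlap (add_mset R \<F>) = (\<lambda>x. indicator R x + overlap \<F> x)"
  by (simp add: overlap_def fun_eq_iff)

lemma overlap_mono: "\<F> \<subseteq># \<E> \<Longrightarrow> overlap \<F> x \<le> overlap \<E> x"
  by (auto simp: overlap_def subset_mset.le_iff_add)

lemma overlap_eq_0: "x \<notin> shadow \<F> \<Longrightarrow> overlap \<F> x = 0"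
  by (induction \<F>) (auto simp: shadow_def)

lemma borel_measurable_overlap:
  "(\<And>R. R \<in># \<F> \<Longrightarrow> R \<in> sets M) \<Longrightarrow> overlap \<F> \<in> borel_measurable M"
  by (induction \<F>) auto

lemma nn_integral_overlap:
  assumes "\<And>R. R \<in># \<F> \<Longrightarrow> R \<in> sets M"
  shows "(\<integral>\<^sup>+x. overlap \<F> x \<partial>M) = (\<Sum>R\<in>#\<F>. emeasure M R)"
  using assms
  by (induction \<F>) (auto simp: nn_integral_add borel_measurable_overlap)

lemma shadow_sets: "(\<And>R. R \<in># \<F> \<Longrightarrow> R \<in> sets M) \<Longrightarrow> shadow \<F> \<in> sets M"
  unfolding shadow_def by (intro sets.finite_Union) auto

lemma emeasure_shadow_le:
  "(\<And>R. R \<in># \<F> \<Longrightarrow> R \<in> sets M) \<Longrightarrow> emeasure M (shadow \<F>) \<le> (\<Sum>R\<in>#\<F>. emeasure M R)"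
proof (induction \<F>)
  case (add R \<F>)
  have "emeasure M (shadow (add_mset R \<F>)) \<le> emeasure M R + emeasure M (shadow \<F>)"
    using emeasure_subadditive[of R M "shadow \<F>"] add.prems shadow_sets[of \<F> M]
    by (auto simp: shadow_def)
  also have "\<dots> \<le> emeasure M R + (\<Sum>R\<in>#\<F>. emeasure M R)"
    using add by (intro add_left_mono) auto
  finally show ?case by simp
qed (simp add: shadow_def)

text \<open>Treats collections with null shadow: their Carleson quotient is
  \<open>0 / 0 = 0\<close>, so total mass zero has to be obtained from monotonicity of the
  measure.\<close>

lemma sum_mset_emeasure_eq_0:
  assumes "\<And>R. R \<in># \<F> \<Longrightarrow> R \<in> sets M" "emeasure M (shadow \<F>) = 0"
  shows "(\<Sum>R\<in>#\<F>. emeasure M R) = 0"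
proof -
  have "emeasure M R = 0" if "R \<in># \<F>" for R
    using emeasure_mono[of R "shadow \<F>" M] that assms shadow_sets[of \<F> M]
    by (auto simp: shadow_def)
  then show ?thesis by auto
qed

lemma sum_mset_emeasure_finite:
  "(\<And>R. R \<in># \<F> \<Longrightarrow> emeasure M R < \<infinity>) \<Longrightarrow> (\<Sum>R\<in>#\<F>. emeasure M R) < \<infinity>"
  by (induction \<F>) auto

text \<open>A supremum over fewer sets gives a pointwise smaller maximal function, so every constant
  admissible for \<open>\<E>\<close> is admissible for \<open>\<F>\<close>. This lets the constants
  of all stages be compared with the initial one.\<close>

lemma maximal_const_mono:
  assumes "\<F> \<subseteq># \<E>" and sets: "\<And>R. R \<in># \<E> \<Longrightarrow> R \<in> sets M"
  shows "maximal_const M \<eta> \<F> \<le> maximal_const M \<eta> \<E>"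
  unfolding maximal_const_def
proof (intro Inf_superset_mono Collect_mono impI ballI)
  fix C E
  assume C: "\<forall>E\<in>sets M. emeasure M {x\<in>space M. maximal_op M \<E> (indicator E) x > ennreal \<eta>}
      \<le> C * emeasure M E" and E: "E \<in> sets M"
  have "maximal_op M \<F> f x \<le> maximal_op M \<E> f x" for f x
    unfolding maximal_op_def by (intro SUP_subset_mono set_mset_mono assms) auto
  \<comment> \<open>Comparing superlevel sets by \<open>emeasure_mono\<close> requires the larger
    one to be measurable.\<close>
  moreover have "maximal_op M \<E> f \<in> borel_measurable M" for f
    unfolding maximal_op_def
    using sets by (intro borel_measurable_SUP) (auto intro: countable_finite)
  ultimately have "emeasure M {x\<in>space M. maximal_op M \<F> (indicator E) x > ennreal \<eta>}
      \<le> emeasure M {x\<in>space M. maximal_op M \<E> (indicator E) x > ennreal \<eta>}"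
    by (intro emeasure_mono) (auto intro: less_le_trans)
  then show "emeasure M {x\<in>space M. maximal_op M \<F> (indicator E) x > ennreal \<eta>} \<le> C * emeasure M E"
    using C E by (meson order_trans)
qed

lemma carleson_const_mono:
  "\<F> \<subseteq># \<E> \<Longrightarrow> carleson_const M \<F> \<le> carleson_const M \<E>"
  unfolding carleson_const_def by (intro SUP_subset_mono) (auto intro: subset_mset.order_trans)

lemma sum_mset_emeasure_le_carleson_const:
  assumes "\<And>R. R \<in># \<F> \<Longrightarrow> R \<in> sets M \<and> emeasure M R < \<infinity>"
  shows "(\<Sum>R\<in>#\<F>. emeasure M R) \<le> carleson_const M \<F> * emeasure M (shadow \<F>)"
proof (cases "emeasure M (shadow \<F>) = 0")
  case True
  then show ?thesis using sum_mset_emeasure_eq_0[of \<F> M] assms by simp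
next
  case False
  \<comment> \<open>Finiteness matters for cancelling the denominator: in \<open>ennreal\<close> a
    quotient by infinity is 0.\<close>
  have "emeasure M (shadow \<F>) < \<infinity>"
    using emeasure_shadow_le[of \<F> M] sum_mset_emeasure_finite[of \<F> M] assms
    by (meson order_le_less_trans)
  then have "(\<Sum>R\<in>#\<F>. emeasure M R)
      = (\<Sum>R\<in>#\<F>. emeasure M R) / emeasure M (shadow \<F>) * emeasure M (shadow \<F>)"
    using False by (simp add: ennreal_divide_times ennreal_times_divide
        mult_divide_eq_ennreal less_top)
  also have "\<dots> \<le> carleson_const M \<F> * emeasure M (shadow \<F>)"
    unfolding carleson_const_def by (intro mult_right_mono SUP_upper) auto
  finally show ?thesis .
qed

text \<open>By Chebyshev, the Carleson constant is admissible in the infimum defining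
  \<open>weak_const\<close>: the integral of the overlap function is the total mass.\<close>

lemma weak_const_le_carleson_const:
  assumes "\<And>R. R \<in># \<F> \<Longrightarrow> R \<in> sets M \<and> emeasure M R < \<infinity>"
  shows "weak_const M \<F> \<le> carleson_const M \<F>"
  unfolding weak_const_def
proof (intro Inf_lower CollectI SUP_least)
  fix l :: real
  have meas [measurable]: "overlap \<F> \<in> borel_measurable M"
    using assms by (intro borel_measurable_overlap) auto
  have "ennreal l * emeasure M {x\<in>space M. overlap \<F> x > ennreal l}
      = (\<integral>\<^sup>+x. ennreal l * indicator {x\<in>space M. overlap \<F> x > ennreal l} x \<partial>M)"
    by (subst nn_integral_cmult_indicator) auto
  also have "\<dots> \<le> (\<integral>\<^sup>+x. overlap \<F> x \<partial>M)"
    by (intro nn_integral_mono) (auto split: split_indicator)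
  also have "\<dots> \<le> carleson_const M \<F> * emeasure M (shadow \<F>)"
    using sum_mset_emeasure_le_carleson_const[of \<F> M] assms by (simp add: nn_integral_overlap)
  finally show "ennreal l * emeasure M {x\<in>space M. overlap \<F> x > ennreal l}
      \<le> carleson_const M \<F> * emeasure M (shadow \<F>)" .
qed

text \<open>A single set of positive finite measure has quotient 1. This accounts for the starting
  value 1 of the algorithm.\<close>

lemma one_le_carleson_const:
  assumes "R \<in># \<E>" "0 < emeasure M R" "emeasure M R < \<infinity>"
  shows "1 \<le> carleson_const M \<E>"
proof -
  have "(\<Sum>R\<in>#{#R#}. emeasure M R) / emeasure M (shadow {#R#}) \<le> carleson_const M \<E>"
    unfolding carleson_const_def using assms by (intro SUP_upper) auto
  then show ?thesis
    using assms by (simp add: shadow_def ennreal_divide_self less_top)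
qed

lemma greedy_loop_ge: "greedy_loop M \<eta> \<E> A B out \<Longrightarrow> A \<le> B"
  by (induction rule: greedy_loop.induct) auto

text \<open>\<open>B\<close> is the maximum of \<open>A\<close> and the weak constants of the
  successive stages, all of which are subcollections of \<open>\<E>\<close>.\<close>

lemma greedy_loop_le:
  assumes "greedy_loop M \<eta> \<E> A B out" "\<And>\<F>. \<F> \<subseteq># \<E> \<Longrightarrow> weak_const M \<F> \<le> C"
  shows "B \<le> max A C"
  using assms
proof (induction rule: greedy_loop.induct)
  case (step R \<E> A B out)
  have "weak_const M \<E> \<le> C" using step.prems by auto
  moreover have "B \<le> max (max A (weak_const M \<E>)) C"
    using step.IH step.prems by (meson diff_subset_eq_self subset_mset.order_trans)
  ultimately show ?case by (simp add: max.assoc max.absorb2)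
qed simp

text \<open>The function \<open>g\<close> below is the sum of the indicators of the sets \<open>E(R)\<close>, \<open>R \<in> \<F>\<close>.\<close>

lemma greedy_loop_density:
  assumes "greedy_loop M \<eta> \<E> A B out"
    and "\<And>R. R \<in># \<E> \<Longrightarrow> R \<in> sets M"
    and "maximal_const M \<eta> \<E> \<le> m" "\<F> \<subseteq># \<E>"
  shows "\<exists>g\<in>borel_measurable M. (\<forall>x. g x \<le> 2 * m * B) \<and> (\<forall>x. g x \<le> overlap \<F> x) \<and>
      ennreal (1 - \<eta>) * (\<Sum>R\<in>#\<F>. emeasure M R) \<le> (\<integral>\<^sup>+x. g x \<partial>M)"
  using assms
proof (induction arbitrary: \<F> rule: greedy_loop.induct)
  case (stop A)
  then show ?case by (intro bexI[of _ "\<lambda>_. 0"]) auto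
next
  case (step R \<E> A B out)
  have sub: "\<E> - {#R#} \<subseteq># \<E>" by simp
  have sets: "\<And>R'. R' \<in># \<E> - {#R#} \<Longrightarrow> R' \<in> sets M"
    using step.prems(1) by (meson in_diffD)
  \<comment> \<open>The threshold of each stage uses the maximal constant of the current collection;
    the fixed bound \<open>m\<close> survives the removal, so the induction hypothesis
    applies.\<close>
  have "maximal_const M \<eta> (\<E> - {#R#}) \<le> m"
    using maximal_const_mono[OF sub step.prems(1)] step.prems(2) by (meson order_trans)
  note IH = step.IH[OF _ this]
  \<comment> \<open>The removed occurrence is charged to \<open>\<F>\<close> only if
    \<open>\<F>\<close> no longer fits into what remains, that is, if it uses every copy of
    \<open>R\<close>. A spare copy of a repeated set is skipped.\<close>
  show ?case
  proof (cases "\<F> \<subseteq># \<E> - {#R#}")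
    case True
    then show ?thesis using IH sets by blast
  next
    case False
    have "R \<in># \<F>"
    proof (rule ccontr)
      assume "R \<notin># \<F>"
      then have "count \<F> Q \<le> count (\<E> - {#R#}) Q" for Q
        using mset_subset_eq_count[OF step.prems(3), of Q] by (auto simp: not_in_iff)
      then show False using False by (simp add: subseteq_mset_def)
    qed
    then obtain \<G> where F: "\<F> = add_mset R \<G>" by (meson mset_add)
    have "\<G> \<subseteq># \<E> - {#R#}"
      using step.prems(3) step.hyps(1) unfolding F by (metis insert_DiffM mset_subset_eq_add_mset_cancel)
    with IH sets obtain g where [measurable]: "g \<in> borel_measurable M"
      and gB: "\<And>x. g x \<le> 2 * m * B" and gh: "\<And>x. g x \<le> overlap \<G> x"
      and gI: "ennreal (1 - \<eta>) * (\<Sum>R\<in>#\<G>. emeasure M R) \<le> (\<integral>\<^sup>+x. g x \<partial>M)" by blast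
    define S where "S = greedy_part M \<eta> \<E> R"
    have R: "R \<in> sets M" using step by auto
    have [measurable]: "overlap \<E> \<in> borel_measurable M"
      using step.prems(1) by (rule borel_measurable_overlap)
    have "S = R \<inter> {x\<in>space M. overlap \<E> x \<le> 2 * maximal_const M \<eta> \<E> * weak_const M \<E>}"
      using sets.sets_into_space[OF R] by (auto simp: S_def greedy_part_def)
    also have "\<dots> \<in> sets M" using R by (intro sets.Int borel_measurable_le) auto
    finally have S [measurable]: "S \<in> sets M" .
    have SR: "S \<subseteq> R" by (auto simp: S_def greedy_part_def)
    have \<Lambda>: "weak_const M \<E> \<le> B" using greedy_loop_ge[OF step.hyps(3)] by simp
    have h: "indicator S x + g x \<le> overlap \<F> x" for x
      unfolding F overlap_add_mset using SR gh by (intro add_mono) (auto split: split_indicator)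
    \<comment> \<open>On \<open>S\<close> the whole sum is at most \<open>overlap \<E>\<close>,
      hence at most the threshold in \<open>greedy_part\<close>, so adding the new indicator does
      not worsen the bound. Off \<open>S\<close> the inductive bound on \<open>g\<close>
      persists.\<close>
    have b: "indicator S x + g x \<le> 2 * m * B" for x
    proof (cases "x \<in> S")
      case True
      have "indicator S x + g x \<le> overlap \<E> x"
        using h overlap_mono[OF step.prems(3)] by (meson order_trans)
      also have "\<dots> \<le> 2 * maximal_const M \<eta> \<E> * weak_const M \<E>"
        using True by (simp add: S_def greedy_part_def)
      also have "\<dots> \<le> 2 * m * B"
        using \<Lambda> step.prems(2) by (intro mult_mono) auto
      finally show ?thesis .
    qed (use gB in auto)
    have "ennreal (1 - \<eta>) * (\<Sum>R\<in>#\<F>. emeasure M R) \<le> emeasure M S + (\<integral>\<^sup>+x. g x \<partial>M)"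
      using add_mono[OF step.hyps(2) gI] by (simp add: F S_def distrib_left)
    also have "\<dots> = (\<integral>\<^sup>+x. indicator S x + g x \<partial>M)"
      by (simp add: nn_integral_add)
    finally show ?thesis
      using h b by (intro bexI[of _ "\<lambda>x. indicator S x + g x"]) auto
  qed
qed

text \<open>The function from \<open>greedy_loop_density\<close> is bounded and lives on the shadow,
  so its integral is at most the bound times the measure of the shadow. The fraction
  \<open>1 - \<eta>\<close> of the mass that it carries produces the factor
  \<open>inverse (1 - \<eta>)\<close>.\<close>

lemma greedy_loop_carleson_const_le:
  assumes "greedy_loop M \<eta> \<E> A B out" "\<eta> < 1"
    and sets: "\<And>R. R \<in># \<E> \<Longrightarrow> R \<in> sets M \<and> emeasure M R < \<infinity>"
  shows "carleson_const M \<E> \<le> 2 * ennreal (inverse (1 - \<eta>)) * maximal_const M \<eta> \<E> * B"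
  unfolding carleson_const_def
proof (intro SUP_least, unfold mem_Collect_eq)
  fix \<F> assume F: "\<F> \<subseteq># \<E>"
  have Fs: "\<And>R. R \<in># \<F> \<Longrightarrow> R \<in> sets M \<and> emeasure M R < \<infinity>"
    using sets F by (meson mset_subset_eqD)
  let ?s = "\<Sum>R\<in>#\<F>. emeasure M R" and ?C = "2 * maximal_const M \<eta> \<E> * B"
  let ?K = "2 * ennreal (inverse (1 - \<eta>)) * maximal_const M \<eta> \<E> * B"
  obtain g where g: "\<And>x. g x \<le> ?C" "\<And>x. g x \<le> overlap \<F> x"
    "ennreal (1 - \<eta>) * ?s \<le> (\<integral>\<^sup>+x. g x \<partial>M)"
    using greedy_loop_density[OF assms(1) _ order_refl F] sets by blast
  \<comment> \<open>Domination by the overlap function forces \<open>g\<close> to vanish off the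
    shadow.\<close>
  have "g x \<le> ?C * indicator (shadow \<F>) x" for x
    using g(1)[of x] g(2)[of x] overlap_eq_0[of x \<F>] by (cases "x \<in> shadow \<F>") auto
  then have "(\<integral>\<^sup>+x. g x \<partial>M) \<le> (\<integral>\<^sup>+x. ?C * indicator (shadow \<F>) x \<partial>M)"
    by (intro nn_integral_mono) auto
  also have "\<dots> = ?C * emeasure M (shadow \<F>)"
    using shadow_sets[of \<F> M] Fs by (intro nn_integral_cmult_indicator) auto
  finally have le: "ennreal (1 - \<eta>) * ?s \<le> ?C * emeasure M (shadow \<F>)"
    using g(3) by (meson order_trans)
  have "?s = ennreal (inverse (1 - \<eta>)) * (ennreal (1 - \<eta>) * ?s)"
    using \<open>\<eta> < 1\<close> by (simp add: mult.assoc[symmetric] ennreal_mult[symmetric])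
  also have "\<dots> \<le> ennreal (inverse (1 - \<eta>)) * (?C * emeasure M (shadow \<F>))"
    using le by (intro mult_left_mono) auto
  finally have s: "?s \<le> ?K * emeasure M (shadow \<F>)" by (simp add: ac_simps)
  show "?s / emeasure M (shadow \<F>) \<le> ?K"
  proof (cases "emeasure M (shadow \<F>) = 0")
    case True
    then show ?thesis using sum_mset_emeasure_eq_0[of \<F> M] Fs by simp
  next
    case False
    then show ?thesis using s by (intro divide_le_posI_ennreal) (auto simp: mult.commute zero_less_iff_neq_zero)
  qed
qed

theorem corollary3p3:
  fixes M :: "(real ^ 'd) measure"
    and \<eta> :: real
    and \<E> :: "(real ^ 'd) set multiset"
    and A :: ennreal
    and out :: "((real ^ 'd) set \<times> ennreal \<times> (real ^ 'd) set) list"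
  assumes "space M = UNIV"
    and "0 < \<eta>" and "\<eta> < 1"
    and "\<And>R. R \<in># \<E> \<Longrightarrow> R \<in> sets M \<and> emeasure M R < \<infinity>"
    and "\<exists>R. R \<in># \<E> \<and> emeasure M R > 0"
    and "maximal_const M \<eta> \<E> < \<infinity>"
    and "improved_greedy M \<eta> \<E> A out"
  shows "A \<le> carleson_const M \<E> \<and>
         carleson_const M \<E> \<le> 2 * ennreal (inverse (1 - \<eta>)) * maximal_const M \<eta> \<E> * A"
proof
  have loop: "greedy_loop M \<eta> \<E> 1 A out"
    using assms(7) by (simp add: improved_greedy_def)
  \<comment> \<open>Each stage of the loop is a subcollection, whose own Carleson constant is at
    most that of \<open>\<E>\<close>.\<close>
  have "weak_const M \<F> \<le> carleson_const M \<E>" if "\<F> \<subseteq># \<E>" for \<F>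
    using weak_const_le_carleson_const[of \<F> M] carleson_const_mono[OF that] assms(4) that
    by (meson mset_subset_eqD order_trans)
  from greedy_loop_le[OF loop this] have "A \<le> max 1 (carleson_const M \<E>)" .
  moreover have "1 \<le> carleson_const M \<E>"
    using assms(4,5) one_le_carleson_const by blast
  ultimately show "A \<le> carleson_const M \<E>" by (simp add: max.absorb2)
  show "carleson_const M \<E> \<le> 2 * ennreal (inverse (1 - \<eta>)) * maximal_const M \<eta> \<E> * A"
    using loop assms(3,4) by (rule greedy_loop_carleson_const_le)
qed

end
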